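(* Let $(Y,\rho)$ be a compact metric space, $f:Y\to Y$ a continuous map, and $\vartheta$ an $f$-invariant Borel probability measure on $Y$. Put $h(q)=\overline{\mathcal{E}}^P_{\vartheta,q}(f,Y)$ for $q\in\mathbb{R}$, $\underline{\beta}=\sup_{q>0}-\frac{h(q)}{q}$ and $\overline{\beta}=\inf_{q<0}-\frac{h(q)}{q}$. Then $$\underline{\beta}\le\inf_{x\in Y}\overline{\mathcal{E}}_\vartheta(f,x)\le\sup_{x\in Y}\underline{\mathcal{E}}_\vartheta(f,x)\le\overline{\beta}.$$ Hence $L_\beta=\emptyset$ for $\beta\notin[\underline{\beta},\overline{\beta}]$.
   Context: For $n\ge1$ put $\rho_n(x,y)=\max_{0\le i\le n-1}\rho(f^i x,f^i y)$, $B^n_\varepsilon(x)=\{y\in Y:\rho_n(x,y)<\varepsilon\}$ and $\overline{B}^n_\varepsilon(x)=\{y\in Y:\rho_n(x,y)\le\varepsilon\}$. A centered $(N,\varepsilon)$-packing of $A\subseteq Y$ is a finite or countable family $\{\overline{B}^{n_i}_\varepsilon(x_i)\}_i$ of pairwise disjoint closed Bowen balls with $x_i\in A$ and $n_i\ge N$. Local entropies: $\overline{\mathcal{E}}_\vartheta(f,x)=\lim_{\varepsilon\to0}\limsup_{n\to\infty}-\frac1n\log\vartheta(B^n_\varepsilon(x))$ and $\underline{\mathcal{E}}_\vartheta(f,x)=\lim_{\varepsilon\to0}\liminf_{n\to\infty}-\frac1n\log\vartheta(B^n_\varepsilon(x))$. Level set: $L_\beta=\{x\in Y:\underline{\mathcal{E}}_\vartheta(f,x)=\overline{\mathcal{E}}_\vartheta(f,x)=\beta\}$.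 For $s\in\mathbb{R}$, $\Psi_s:[0,\infty)\to[0,\infty]$ is: for $s<0$, $\Psi_s(0)=\infty$ and $\Psi_s(x)=x^s$ for $x>0$; $\Psi_0\equiv1$; for $s>0$, $\Psi_s(x)=x^s$. For $A\subseteq Y$, $q,t\in\mathbb{R}$: $\overline{\mathcal{P}}^{q,t}_{N,\varepsilon,\vartheta}(A)=\sup\sum_i\Psi_q(\vartheta(B^{n_i}_\varepsilon(x_i)))e^{-tn_i}$, the supremum over all centered $(N,\varepsilon)$-packings of $A$; $\overline{\mathcal{P}}^{q,t}_{\varepsilon,\vartheta}(A)=\lim_{N\to\infty}\overline{\mathcal{P}}^{q,t}_{N,\varepsilon,\vartheta}(A)$; $\mathcal{P}^{q,t}_{\varepsilon,\vartheta}(A)=\inf\{\sum_i\overline{\mathcal{P}}^{q,t}_{\varepsilon,\vartheta}(A_i): A\subseteq\bigcup_iA_i\}$ over countable covers. $\mathcal{E}^P_{\vartheta,q}(f,A,\varepsilon)\in[-\infty,\infty]$ is the unique number such that $\mathcal{P}^{q,t}_{\varepsilon,\vartheta}(A)=\infty$ for $t<\mathcal{E}^P_{\vartheta,q}(f,A,\varepsilon)$ and $=0$ for $t>\mathcal{E}^P_{\vartheta,q}(f,A,\varepsilon)$; $\overline{\mathcal{E}}^P_{\vartheta,q}(f,A)=\limsup_{\varepsilon\to0}\mathcal{E}^P_{\vartheta,q}(f,A,\varepsilon)$. *)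

theory Defs
  imports "HOL-Probability.Probability"
begin

text \<open>
  The compact metric space \<open>Y\<close> is the universe of a type \<open>'a :: metric_space\<close>. The value
  of \<open>bowen_dist\<close> at \<open>n = 0\<close> (the maximum of the empty set) is unspecified; every notion
  that depends on it is a limit as \<open>n\<close> tends to infinity.
\<close>

definition bowen_dist :: "('a::metric_space \<Rightarrow> 'a) \<Rightarrow> nat \<Rightarrow> 'a \<Rightarrow> 'a \<Rightarrow> real" where
  "bowen_dist f n x y = Max ((\<lambda>i. dist ((f ^^ i) x) ((f ^^ i) y)) ` {..<n})"

definition bowen_ball :: "('a::metric_space \<Rightarrow> 'a) \<Rightarrow> nat \<Rightarrow> real \<Rightarrow> 'a \<Rightarrow> 'a set" where
  "bowen_ball f n \<epsilon> x = {y. bowen_dist f n x y < \<epsilon>}"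

definition bowen_cball :: "('a::metric_space \<Rightarrow> 'a) \<Rightarrow> nat \<Rightarrow> real \<Rightarrow> 'a \<Rightarrow> 'a set" where
  "bowen_cball f n \<epsilon> x = {y. bowen_dist f n x y \<le> \<epsilon>}"

definition invariant_borel_prob :: "('a::metric_space \<Rightarrow> 'a) \<Rightarrow> 'a measure \<Rightarrow> bool" where
  "invariant_borel_prob f \<theta> \<longleftrightarrow>
     prob_space \<theta> \<and> sets \<theta> = sets borel \<and>
     (\<forall>A\<in>sets borel. measure \<theta> (f -` A) = measure \<theta> A)"

text \<open>The convention \<open>log 0 = -\<infinity>\<close>: a ball of measure zero has decay rate \<open>\<infinity>\<close>.\<close>

definition decay_rate ::
  "('a::metric_space \<Rightarrow> 'a) \<Rightarrow> 'a measure \<Rightarrow> 'a \<Rightarrow> real \<Rightarrow> nat \<Rightarrow> ereal" where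
  "decay_rate f \<theta> x \<epsilon> n =
     (if measure \<theta> (bowen_ball f n \<epsilon> x) = 0 then \<infinity>
      else ereal (- (1 / real n) * ln (measure \<theta> (bowen_ball f n \<epsilon> x))))"

definition upper_local_entropy ::
  "('a::metric_space \<Rightarrow> 'a) \<Rightarrow> 'a measure \<Rightarrow> 'a \<Rightarrow> ereal" where
  "upper_local_entropy f \<theta> x =
     Lim (at_right 0) (\<lambda>\<epsilon>::real. limsup (\<lambda>n. decay_rate f \<theta> x \<epsilon> n))"

definition lower_local_entropy ::
  "('a::metric_space \<Rightarrow> 'a) \<Rightarrow> 'a measure \<Rightarrow> 'a \<Rightarrow> ereal" where
  "lower_local_entropy f \<theta> x =
     Lim (at_right 0) (\<lambda>\<epsilon>::real. liminf (\<lambda>n. decay_rate f \<theta> x \<epsilon> n))"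

definition entropy_level_set ::
  "('a::metric_space \<Rightarrow> 'a) \<Rightarrow> 'a measure \<Rightarrow> ereal \<Rightarrow> 'a set" where
  "entropy_level_set f \<theta> \<beta> =
     {x. lower_local_entropy f \<theta> x = \<beta> \<and> upper_local_entropy f \<theta> x = \<beta>}"

definition Psi :: "real \<Rightarrow> real \<Rightarrow> ennreal" where
  "Psi s x =
     (if s = 0 then 1 else if s < 0 \<and> x = 0 then \<infinity> else ennreal (x powr s))"

text \<open>
  A finite or countable family of balls is given by its centres \<open>x i\<close> and orders \<open>n i\<close> for
  \<open>i\<close> in an index set \<open>I\<close> of natural numbers.
\<close>

definition centered_packing ::
  "('a::metric_space \<Rightarrow> 'a) \<Rightarrow> nat \<Rightarrow> real \<Rightarrow> 'a set \<Rightarrow>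
     nat set \<Rightarrow> (nat \<Rightarrow> nat) \<Rightarrow> (nat \<Rightarrow> 'a) \<Rightarrow> bool" where
  "centered_packing f N \<epsilon> A I n x \<longleftrightarrow>
     (\<forall>i\<in>I. x i \<in> A \<and> N \<le> n i) \<and>
     disjoint_family_on (\<lambda>i. bowen_cball f (n i) \<epsilon> (x i)) I"

definition packing_premeasure_at ::
  "('a::metric_space \<Rightarrow> 'a) \<Rightarrow> 'a measure \<Rightarrow> real \<Rightarrow> real \<Rightarrow> nat \<Rightarrow> real \<Rightarrow> 'a set \<Rightarrow> ennreal" where
  "packing_premeasure_at f \<theta> q t N \<epsilon> A =
     Sup {(\<Sum>\<^sub>\<infinity>i\<in>I. Psi q (measure \<theta> (bowen_ball f (n i) \<epsilon> (x i)))
                     * ennreal (exp (- t * real (n i)))) | I n x.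
          centered_packing f N \<epsilon> A I n x}"

definition packing_premeasure ::
  "('a::metric_space \<Rightarrow> 'a) \<Rightarrow> 'a measure \<Rightarrow> real \<Rightarrow> real \<Rightarrow> real \<Rightarrow> 'a set \<Rightarrow> ennreal" where
  "packing_premeasure f \<theta> q t \<epsilon> A = lim (\<lambda>N. packing_premeasure_at f \<theta> q t N \<epsilon> A)"

text \<open>
  Countable covers are sequences of sets. This includes the finite covers, which can be padded
  with empty sets, on which the premeasure vanishes.
\<close>

definition packing_measure ::
  "('a::metric_space \<Rightarrow> 'a) \<Rightarrow> 'a measure \<Rightarrow> real \<Rightarrow> real \<Rightarrow> real \<Rightarrow> 'a set \<Rightarrow> ennreal" where
  "packing_measure f \<theta> q t \<epsilon> A =
     Inf {(\<Sum>i. packing_premeasure f \<theta> q t \<epsilon> (C i)) | C :: nat \<Rightarrow> 'a set. A \<subseteq> (\<Union>i. C i)}"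

definition is_packing_threshold ::
  "('a::metric_space \<Rightarrow> 'a) \<Rightarrow> 'a measure \<Rightarrow> real \<Rightarrow> 'a set \<Rightarrow> real \<Rightarrow> ereal \<Rightarrow> bool" where
  "is_packing_threshold f \<theta> q A \<epsilon> E \<longleftrightarrow>
     (\<forall>t::real. (ereal t < E \<longrightarrow> packing_measure f \<theta> q t \<epsilon> A = \<infinity>) \<and>
                (E < ereal t \<longrightarrow> packing_measure f \<theta> q t \<epsilon> A = 0))"

definition packing_entropy_at ::
  "('a::metric_space \<Rightarrow> 'a) \<Rightarrow> 'a measure \<Rightarrow> real \<Rightarrow> 'a set \<Rightarrow> real \<Rightarrow> ereal" where
  "packing_entropy_at f \<theta> q A \<epsilon> = (THE E. is_packing_threshold f \<theta> q A \<epsilon> E)"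

definition upper_packing_entropy ::
  "('a::metric_space \<Rightarrow> 'a) \<Rightarrow> 'a measure \<Rightarrow> real \<Rightarrow> 'a set \<Rightarrow> ereal" where
  "upper_packing_entropy f \<theta> q A =
     Limsup (at_right 0) (\<lambda>\<epsilon>::real. packing_entropy_at f \<theta> q A \<epsilon>)"

definition beta_lower :: "('a::metric_space \<Rightarrow> 'a) \<Rightarrow> 'a measure \<Rightarrow> ereal" where
  "beta_lower f \<theta> = (SUP q\<in>{0<..}. - (upper_packing_entropy f \<theta> q UNIV / ereal q))"

definition beta_upper :: "('a::metric_space \<Rightarrow> 'a) \<Rightarrow> 'a measure \<Rightarrow> ereal" where
  "beta_upper f \<theta> = (INF q\<in>{..<0}. - (upper_packing_entropy f \<theta> q UNIV / ereal q))"

text \<open>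
  The remaining facts show that \<open>packing_entropy_at\<close> is well defined: the threshold exists and is
  unique, for all \<open>f\<close>, \<open>\<theta>\<close>, \<open>q\<close>, \<open>A\<close> and \<open>\<epsilon>\<close>.
\<close>

lemma packing_premeasure_at_decseq: "decseq (\<lambda>N. packing_premeasure_at f \<theta> q t N \<epsilon> A)"
proof (rule antimonoI)
  fix M N :: nat
  assume "M \<le> N"
  then have "centered_packing f M \<epsilon> A I n x" if "centered_packing f N \<epsilon> A I n x" for I n x
    using that by (auto simp: centered_packing_def)
  then show "packing_premeasure_at f \<theta> q t N \<epsilon> A \<le> packing_premeasure_at f \<theta> q t M \<epsilon> A"
    unfolding packing_premeasure_at_def by (intro Sup_subset_mono) blast
qed

lemma packing_premeasure_eq_INF:
  "packing_premeasure f \<theta> q t \<epsilon> A = (INF N. packing_premeasure_at f \<theta> q t N \<epsilon> A)"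
  unfolding packing_premeasure_def
  by (intro limI LIMSEQ_INF packing_premeasure_at_decseq)

lemma infsum_cmult_le_ennreal:
  fixes g h :: "'i \<Rightarrow> ennreal"
  assumes "\<And>i. i \<in> I \<Longrightarrow> g i \<le> c * h i"
  shows "infsum g I \<le> c * infsum h I"
proof -
  have "sum g F \<le> c * infsum h I" if F: "finite F" "F \<subseteq> I" for F
  proof -
    have "sum g F \<le> (\<Sum>i\<in>F. c * h i)"
      by (intro sum_mono assms) (use F in auto)
    also have "\<dots> = c * sum h F"
      by (simp add: sum_distrib_left)
    also have "\<dots> \<le> c * infsum h I"
      by (intro mult_left_mono) (auto simp: nonneg_infsum_complete intro!: SUP_upper F)
    finally show ?thesis .
  qed
  then show ?thesis
    by (auto simp: nonneg_infsum_complete[of I g] intro!: SUP_least)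
qed

lemma packing_premeasure_at_shift:
  assumes "s < t"
  shows "packing_premeasure_at f \<theta> q t N \<epsilon> A
           \<le> ennreal (exp (- (t - s) * real N)) * packing_premeasure_at f \<theta> q s N \<epsilon> A"
    (is "_ \<le> ?c * _")
proof -
  have "(\<Sum>\<^sub>\<infinity>i\<in>I. Psi q (measure \<theta> (bowen_ball f (n i) \<epsilon> (x i))) * ennreal (exp (- t * real (n i))))
          \<le> ?c * packing_premeasure_at f \<theta> q s N \<epsilon> A" (is "infsum ?g I \<le> _")
    if P: "centered_packing f N \<epsilon> A I n x" for I n x
  proof -
    let ?h = "\<lambda>i. Psi q (measure \<theta> (bowen_ball f (n i) \<epsilon> (x i))) * ennreal (exp (- s * real (n i)))"
    have "?g i \<le> ?c * ?h i" if "i \<in> I" for i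
    proof -
      have "N \<le> n i"
        using P that by (auto simp: centered_packing_def)
      then have "(t - s) * real N \<le> (t - s) * real (n i)"
        using assms by (intro mult_left_mono) auto
      then have "exp (- t * real (n i)) \<le> exp (- (t - s) * real N) * exp (- s * real (n i))"
        by (simp add: exp_add[symmetric] algebra_simps)
      then have "ennreal (exp (- t * real (n i))) \<le> ?c * ennreal (exp (- s * real (n i)))"
        by (simp add: ennreal_mult[symmetric] ennreal_leI)
      then have "?g i \<le> Psi q (measure \<theta> (bowen_ball f (n i) \<epsilon> (x i)))
                           * (?c * ennreal (exp (- s * real (n i))))"
        by (intro mult_left_mono) auto
      then show ?thesis
        by (simp only: mult.left_commute)
    qed
    then have "infsum ?g I \<le> ?c * infsum ?h I"
      by (rule infsum_cmult_le_ennreal)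
    also have "\<dots> \<le> ?c * packing_premeasure_at f \<theta> q s N \<epsilon> A"
      unfolding packing_premeasure_at_def
      by (intro mult_left_mono Sup_upper) (use P in auto)
    finally show ?thesis .
  qed
  then show ?thesis
    unfolding packing_premeasure_at_def[of f \<theta> q t] by (auto intro!: Sup_least)
qed

lemma packing_premeasure_vanishes:
  assumes "s < t" "packing_premeasure f \<theta> q s \<epsilon> A < \<infinity>"
  shows "packing_premeasure f \<theta> q t \<epsilon> A = 0"
proof -
  let ?P = "\<lambda>t N. packing_premeasure_at f \<theta> q t N \<epsilon> A"
  obtain M where M: "?P s M < \<infinity>"
    using assms(2) by (auto simp: packing_premeasure_eq_INF INF_less_iff)
  have "(\<lambda>N. exp (- (t - s) * real N)) \<longlonglongrightarrow> 0"
  proof -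
    have "(\<lambda>N. exp (- (t - s)) ^ N) \<longlonglongrightarrow> 0"
      by (intro LIMSEQ_realpow_zero) (use assms(1) in auto)
    then show ?thesis
      by (simp add: exp_of_nat_mult[symmetric] mult.commute)
  qed
  then have "(\<lambda>N. ennreal (exp (- (t - s) * real N))) \<longlonglongrightarrow> 0"
    using tendsto_ennrealI by fastforce
  then have "(\<lambda>N. ?P s M * ennreal (exp (- (t - s) * real N))) \<longlonglongrightarrow> ?P s M * 0"
    using M by (intro ennreal_tendsto_cmult) auto
  then have lim0: "(\<lambda>N. ?P s M * ennreal (exp (- (t - s) * real N))) \<longlonglongrightarrow> 0"
    by simp
  have "packing_premeasure f \<theta> q t \<epsilon> A \<le> ?P s M * ennreal (exp (- (t - s) * real N))"
    if "M \<le> N" for N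
  proof -
    have "packing_premeasure f \<theta> q t \<epsilon> A \<le> ?P t N"
      by (auto simp: packing_premeasure_eq_INF intro: INF_lower)
    also have "\<dots> \<le> ennreal (exp (- (t - s) * real N)) * ?P s N"
      by (rule packing_premeasure_at_shift[OF assms(1)])
    also have "\<dots> \<le> ennreal (exp (- (t - s) * real N)) * ?P s M"
      by (intro mult_left_mono decseqD[OF packing_premeasure_at_decseq] that) auto
    finally show ?thesis
      by (simp add: mult.commute)
  qed
  then have "packing_premeasure f \<theta> q t \<epsilon> A \<le> 0"
    by (intro LIMSEQ_le_const[OF lim0]) blast
  then show ?thesis
    by simp
qed

lemma packing_measure_vanishes:
  assumes "s < t" "packing_measure f \<theta> q s \<epsilon> A < \<infinity>"
  shows "packing_measure f \<theta> q t \<epsilon> A = 0"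
proof -
  obtain C :: "nat \<Rightarrow> 'a set" where C: "A \<subseteq> (\<Union>i. C i)"
    and fin: "(\<Sum>i. packing_premeasure f \<theta> q s \<epsilon> (C i)) < \<infinity>"
    using assms(2) unfolding packing_measure_def Inf_less_iff by blast
  have "packing_premeasure f \<theta> q s \<epsilon> (C i) < \<infinity>" for i
  proof -
    have "packing_premeasure f \<theta> q s \<epsilon> (C i) \<le> (\<Sum>i. packing_premeasure f \<theta> q s \<epsilon> (C i))"
      using sum_le_suminf[of "\<lambda>i. packing_premeasure f \<theta> q s \<epsilon> (C i)" "{i}"] by auto
    then show ?thesis
      using fin by (rule le_less_trans)
  qed
  then have "(\<Sum>i. packing_premeasure f \<theta> q t \<epsilon> (C i)) = 0"
    by (simp add: packing_premeasure_vanishes[OF assms(1)])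
  then have "packing_measure f \<theta> q t \<epsilon> A \<le> 0"
    unfolding packing_measure_def using C by (intro Inf_lower) force
  then show ?thesis
    by simp
qed

lemma ex1_packing_threshold: "\<exists>!E. is_packing_threshold f \<theta> q A \<epsilon> E"
proof -
  let ?m = "\<lambda>t. packing_measure f \<theta> q t \<epsilon> A"
  let ?E = "Inf (ereal ` {t. ?m t < \<infinity>})"
  have threshold: "is_packing_threshold f \<theta> q A \<epsilon> ?E"
    unfolding is_packing_threshold_def
  proof (intro allI conjI impI)
    fix t :: real
    assume t: "ereal t < ?E"
    show "?m t = \<infinity>"
    proof (rule ccontr)
      assume "?m t \<noteq> \<infinity>"
      then have "?E \<le> ereal t"
        by (intro Inf_lower) (auto simp: top.not_eq_extremum)
      then show False
        using t by simp
    qed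
  next
    fix t :: real
    assume "?E < ereal t"
    then show "?m t = 0"
      unfolding Inf_less_iff by (auto intro: packing_measure_vanishes)
  qed
  have unique: False
      if "is_packing_threshold f \<theta> q A \<epsilon> E" "is_packing_threshold f \<theta> q A \<epsilon> E'" "E < E'" for E E'
      using ereal_dense2[OF that(3)] that unfolding is_packing_threshold_def by fastforce
  show ?thesis
    using threshold unique by (meson linorder_cases)
qed

end

theory Submission
  imports Defs
begin

text \<open>
  Both outer inequalities come from packings that consist of a single ball. If the local entropy
  at \<open>x\<close> is controlled at scale \<open>\<epsilon>\<close>, then \<open>\<Psi>\<^sub>q\<close> of the mass of the ball of order \<open>n\<close> about \<open>x\<close>
  grows at least like \<open>exp (u n)\<close>, for a rate \<open>u\<close> close to \<open>- q\<close> times the local entropy. Such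
  balls, of arbitrarily large order, give every set containing \<open>x\<close>, hence some member of every
  countable cover of the space, infinite packing premeasure for \<open>t < u\<close>; therefore the packing
  entropy is at least \<open>u\<close> (\<open>packing_entropy_at_ge\<close>). For \<open>q > 0\<close> the mass has to be bounded from
  below for all large orders, which is what the upper local entropy does; for \<open>q < 0\<close> it has to be
  bounded from above, which is what the lower local entropy does.

  For the middle inequality suppose that every lower local entropy is below \<open>b\<close> and let
  \<open>b < b' < a\<close>. By compactness finitely many balls of large order \<open>k\<close> and mass at least
  \<open>exp (- b k)\<close> cover the space, and a Vitali selection leaves at most \<open>exp (b k)\<close> of order \<open>k\<close> if
  the radius is tripled. Cutting an orbit into consecutive pieces that follow these balls gives
  covers by sets of small diameter in the metric of order \<open>n\<close>. Giving a piece of length \<open>k\<close> the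
  weight \<open>exp (- b' k)\<close>, the total weight of the pieces is at most 1, and the resulting Kraft
  inequality bounds the number of sets in the cover by a constant times \<open>exp (b' n)\<close>
  (\<open>exponential_open_covers\<close>). Members of mass at most \<open>exp (- a n)\<close> thus have summable total
  mass, and by Borel--Cantelli almost every point lies in only finitely many of them
  (\<open>AE_limsup_decay_rate_le\<close>). At such a point the upper local entropy is at most \<open>a\<close>, so it
  cannot exceed \<open>a\<close> everywhere. Compactness is applicable because the bound on the lower local
  entropy is assumed at every point, and not just at almost every point.
\<close>

section \<open>Bowen balls and local entropies\<close>

lemma mem_bowen_ball:
  "0 < n \<Longrightarrow> y \<in> bowen_ball f n \<epsilon> x \<longleftrightarrow> (\<forall>i<n. dist ((f ^^ i) x) ((f ^^ i) y) < \<epsilon>)"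
  unfolding bowen_ball_def bowen_dist_def by (subst mem_Collect_eq, subst Max_less_iff) auto

lemma bowen_ball_mono: "\<epsilon> \<le> \<epsilon>' \<Longrightarrow> bowen_ball f n \<epsilon> x \<subseteq> bowen_ball f n \<epsilon>' x"
  by (auto simp: bowen_ball_def)

lemma continuous_on_funpow:
  fixes f :: "'a::topological_space \<Rightarrow> 'a"
  assumes "continuous_on UNIV f"
  shows "continuous_on UNIV (f ^^ i)"
proof (induction i)
  case (Suc i)
  then show ?case
    using continuous_on_compose[OF Suc continuous_on_subset[OF assms]] by simp
qed simp

lemma open_bowen_ball:
  assumes "continuous_on UNIV f"
  shows "open (bowen_ball f n \<epsilon> x)"
proof (cases "n = 0")
  case True
  then show ?thesis
    by (simp add: bowen_ball_def bowen_dist_def)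
next
  case False
  then have "bowen_ball f n \<epsilon> x = (\<Inter>i<n. (f ^^ i) -` ball ((f ^^ i) x) \<epsilon>)"
    by (auto simp: mem_bowen_ball)
  moreover have "open ((f ^^ i) -` ball ((f ^^ i) x) \<epsilon>)" for i
    using continuous_on_funpow[OF assms] open_ball by (rule open_vimage[rotated])
  ultimately show ?thesis
    by auto
qed

lemma decay_rate_less_iff:
  assumes "0 < n"
  shows "decay_rate f \<theta> x \<epsilon> n < ereal s \<longleftrightarrow> exp (- s * real n) < measure \<theta> (bowen_ball f n \<epsilon> x)"
proof (cases "measure \<theta> (bowen_ball f n \<epsilon> x) = 0")
  case False
  then have pos: "0 < measure \<theta> (bowen_ball f n \<epsilon> x)"
    by (simp add: zero_less_measure_iff)
  have "decay_rate f \<theta> x \<epsilon> n < ereal s \<longleftrightarrow> - s * real n < ln (measure \<theta> (bowen_ball f n \<epsilon> x))"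
    using assms False by (auto simp: decay_rate_def field_simps)
  also have "\<dots> \<longleftrightarrow> exp (- s * real n) < measure \<theta> (bowen_ball f n \<epsilon> x)"
    using pos by (metis exp_less_cancel_iff exp_ln)
  finally show ?thesis .
qed (simp add: decay_rate_def)

lemma less_decay_rate_iff:
  assumes "0 < n"
  shows "ereal s < decay_rate f \<theta> x \<epsilon> n \<longleftrightarrow> measure \<theta> (bowen_ball f n \<epsilon> x) < exp (- s * real n)"
proof (cases "measure \<theta> (bowen_ball f n \<epsilon> x) = 0")
  case False
  then have pos: "0 < measure \<theta> (bowen_ball f n \<epsilon> x)"
    by (simp add: zero_less_measure_iff)
  have "ereal s < decay_rate f \<theta> x \<epsilon> n \<longleftrightarrow> ln (measure \<theta> (bowen_ball f n \<epsilon> x)) < - s * real n"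
    using assms False by (auto simp: decay_rate_def field_simps)
  also have "\<dots> \<longleftrightarrow> measure \<theta> (bowen_ball f n \<epsilon> x) < exp (- s * real n)"
    using pos by (metis exp_less_cancel_iff exp_ln)
  finally show ?thesis .
qed (simp add: decay_rate_def)

lemma decay_rate_antimono:
  assumes "continuous_on UNIV f" "finite_measure \<theta>" "sets \<theta> = sets borel" "\<epsilon> \<le> \<epsilon>'"
  shows "decay_rate f \<theta> x \<epsilon>' n \<le> decay_rate f \<theta> x \<epsilon> n"
proof (cases "measure \<theta> (bowen_ball f n \<epsilon> x) = 0")
  case False
  then have pos: "0 < measure \<theta> (bowen_ball f n \<epsilon> x)"
    by (simp add: zero_less_measure_iff)
  have le: "measure \<theta> (bowen_ball f n \<epsilon> x) \<le> measure \<theta> (bowen_ball f n \<epsilon>' x)"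
    using assms open_bowen_ball[OF assms(1)]
    by (intro finite_measure.finite_measure_mono bowen_ball_mono) auto
  then have "ln (measure \<theta> (bowen_ball f n \<epsilon> x)) / real n
      \<le> ln (measure \<theta> (bowen_ball f n \<epsilon>' x)) / real n"
    using pos by (intro divide_right_mono) auto
  then show ?thesis
    using pos le by (simp add: decay_rate_def)
qed (simp add: decay_rate_def)

lemma Lim_at_right_0_antimono:
  fixes g :: "real \<Rightarrow> ereal"
  assumes "\<And>\<epsilon> \<epsilon>'. \<epsilon> \<le> \<epsilon>' \<Longrightarrow> g \<epsilon>' \<le> g \<epsilon>"
  shows "Lim (at_right 0) g = (SUP \<epsilon>\<in>{0<..}. g \<epsilon>)"
proof (rule tendsto_Lim)
  show "(g \<longlongrightarrow> (SUP \<epsilon>\<in>{0<..}. g \<epsilon>)) (at_right 0)"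
  proof (rule order_tendstoI)
    fix c
    assume "c < (SUP \<epsilon>\<in>{0<..}. g \<epsilon>)"
    then obtain \<delta> where "0 < \<delta>" "c < g \<delta>"
      by (auto simp: less_SUP_iff)
    then show "\<forall>\<^sub>F \<epsilon> in at_right 0. c < g \<epsilon>"
      unfolding eventually_at_right_field using assms by (meson less_imp_le less_le_trans)
  next
    fix c
    assume c: "(SUP \<epsilon>\<in>{0<..}. g \<epsilon>) < c"
    have "g \<epsilon> < c" if "0 < \<epsilon>" for \<epsilon>
      using that by (intro le_less_trans[OF SUP_upper c]) auto
    then show "\<forall>\<^sub>F \<epsilon> in at_right 0. g \<epsilon> < c"
      unfolding eventually_at_right_field by (auto intro!: exI[of _ 1])
  qed
qed simp

lemma upper_local_entropy_eq_SUP: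
  assumes "continuous_on UNIV f" "finite_measure \<theta>" "sets \<theta> = sets borel"
  shows "upper_local_entropy f \<theta> x = (SUP \<epsilon>\<in>{0<..}. limsup (decay_rate f \<theta> x \<epsilon>))"
  unfolding upper_local_entropy_def
  by (intro Lim_at_right_0_antimono Limsup_mono always_eventually allI
      decay_rate_antimono[OF assms])

lemma lower_local_entropy_eq_SUP:
  assumes "continuous_on UNIV f" "finite_measure \<theta>" "sets \<theta> = sets borel"
  shows "lower_local_entropy f \<theta> x = (SUP \<epsilon>\<in>{0<..}. liminf (decay_rate f \<theta> x \<epsilon>))"
  unfolding lower_local_entropy_def
  by (intro Lim_at_right_0_antimono Liminf_mono always_eventually allI
      decay_rate_antimono[OF assms])

section \<open>Packing entropy from a single point\<close>

text \<open>The packings that witness this consist of one ball, whose order is taken arbitrarily large.\<close>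

lemma packing_premeasure_eq_top:
  assumes growth: "\<forall>\<^sub>F n in sequentially.
      ennreal (exp (u * real n)) \<le> Psi q (measure \<theta> (bowen_ball f n \<epsilon> x))"
    and "x \<in> A" "t < u"
  shows "packing_premeasure f \<theta> q t \<epsilon> A = \<infinity>"
proof -
  have "packing_premeasure_at f \<theta> q t N \<epsilon> A = \<infinity>" for N
  proof -
    have lim: "filterlim (\<lambda>n. ennreal (exp ((u - t) * real n))) (nhds top) sequentially"
    proof -
      have "filterlim (\<lambda>n. exp ((u - t) * real n)) at_top sequentially"
        using assms(3)
        by (intro filterlim_compose[OF exp_at_top]
            filterlim_tendsto_pos_mult_at_top[OF tendsto_const] filterlim_real_sequentially) auto
      then show ?thesis
        by (simp add: ennreal_tendsto_top_eq_at_top)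
    qed
    have "\<forall>\<^sub>F n in sequentially.
        ennreal (exp ((u - t) * real n)) \<le> packing_premeasure_at f \<theta> q t N \<epsilon> A"
      using growth eventually_ge_at_top[of N]
    proof eventually_elim
      case (elim n)
      have "ennreal (exp ((u - t) * real n)) = ennreal (exp (u * real n)) * ennreal (exp (- t * real n))"
        by (simp add: ennreal_mult[symmetric] exp_add[symmetric] algebra_simps)
      also have "\<dots> \<le> Psi q (measure \<theta> (bowen_ball f n \<epsilon> x)) * ennreal (exp (- t * real n))"
        by (intro mult_right_mono elim) auto
      also have "\<dots> = (\<Sum>\<^sub>\<infinity>i\<in>{0::nat}. Psi q (measure \<theta> (bowen_ball f n \<epsilon> x))
                         * ennreal (exp (- t * real n)))"
        by simp
      also have "\<dots> \<le> packing_premeasure_at f \<theta> q t N \<epsilon> A"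
        unfolding packing_premeasure_at_def
      proof (rule Sup_upper, rule CollectI, intro exI conjI)
        show "centered_packing f N \<epsilon> A {0} (\<lambda>_. n) (\<lambda>_. x)"
          using elim assms(2) by (auto simp: centered_packing_def disjoint_family_on_def)
      qed simp
      finally show ?case .
    qed
    then have "top \<le> packing_premeasure_at f \<theta> q t N \<epsilon> A"
      by (intro tendsto_upperbound[OF lim]) auto
    then show ?thesis
      by (simp add: top_unique)
  qed
  then show ?thesis
    by (simp add: packing_premeasure_eq_INF)
qed

lemma packing_entropy_at_ge:
  fixes x :: "'a::metric_space"
  assumes growth: "\<forall>\<^sub>F n in sequentially.
      ennreal (exp (u * real n)) \<le> Psi q (measure \<theta> (bowen_ball f n \<epsilon> x))"
    and "x \<in> A"
  shows "ereal u \<le> packing_entropy_at f \<theta> q A \<epsilon>"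
proof (rule ccontr)
  have threshold: "is_packing_threshold f \<theta> q A \<epsilon> (packing_entropy_at f \<theta> q A \<epsilon>)"
    unfolding packing_entropy_at_def using ex1_packing_threshold by (rule theI')
  assume "\<not> ereal u \<le> packing_entropy_at f \<theta> q A \<epsilon>"
  then obtain t where t: "packing_entropy_at f \<theta> q A \<epsilon> < ereal t" "t < u"
    using ereal_dense2[of "packing_entropy_at f \<theta> q A \<epsilon>" "ereal u"] by (auto simp: not_le)
  have "\<infinity> \<le> (\<Sum>i. packing_premeasure f \<theta> q t \<epsilon> (C i))" if C: "A \<subseteq> (\<Union>i. C i)" for C :: "nat \<Rightarrow> 'a set"
  proof -
    obtain j where "x \<in> C j"
      using \<open>x \<in> A\<close> C by blast
    then have "\<infinity> = packing_premeasure f \<theta> q t \<epsilon> (C j)"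
      using packing_premeasure_eq_top[OF growth _ t(2)] by simp
    also have "\<dots> \<le> (\<Sum>i. packing_premeasure f \<theta> q t \<epsilon> (C i))"
      using sum_le_suminf[of "\<lambda>i. packing_premeasure f \<theta> q t \<epsilon> (C i)" "{j}"] by auto
    finally show ?thesis .
  qed
  then have "\<infinity> \<le> packing_measure f \<theta> q t \<epsilon> A"
    unfolding packing_measure_def by (intro Inf_greatest) blast
  moreover have "packing_measure f \<theta> q t \<epsilon> A = 0"
    using threshold t(1) by (simp add: is_packing_threshold_def)
  ultimately show False
    by simp
qed

lemma upper_packing_entropy_ge:
  assumes "\<forall>\<^sub>F \<epsilon> in at_right 0. \<forall>\<^sub>F n in sequentially.
      ennreal (exp (u * real n)) \<le> Psi q (measure \<theta> (bowen_ball f n \<epsilon> x))"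
    and "x \<in> A"
  shows "ereal u \<le> upper_packing_entropy f \<theta> q A"
proof -
  have "\<forall>\<^sub>F \<epsilon> in at_right 0. ereal u \<le> packing_entropy_at f \<theta> q A \<epsilon>"
    using assms(1) by eventually_elim (rule packing_entropy_at_ge[OF _ assms(2)])
  then have "ereal u \<le> Liminf (at_right 0) (packing_entropy_at f \<theta> q A)"
    by (intro Liminf_bounded)
  also have "\<dots> \<le> upper_packing_entropy f \<theta> q A"
    unfolding upper_packing_entropy_def by (intro Liminf_le_Limsup) simp
  finally show ?thesis .
qed

text \<open>
  For \<open>s\<close> above the upper local entropy, the mass of the balls about \<open>x\<close> is eventually larger than
  \<open>exp (- s n)\<close> at every scale, which gives the growth rate \<open>u = - s q\<close>.
\<close>

lemma beta_lower_le_upper_local_entropy: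
  assumes "continuous_on UNIV f" "finite_measure \<theta>" "sets \<theta> = sets borel"
  shows "beta_lower f \<theta> \<le> upper_local_entropy f \<theta> x"
  unfolding beta_lower_def
proof (intro SUP_least)
  fix q :: real
  assume "q \<in> {0<..}"
  then have q: "0 < q"
    by simp
  let ?h = "upper_packing_entropy f \<theta> q UNIV"
  show "- (?h / ereal q) \<le> upper_local_entropy f \<theta> x"
  proof (rule ccontr)
    assume "\<not> ?thesis"
    then obtain s where s: "upper_local_entropy f \<theta> x < ereal s" "ereal s < - (?h / ereal q)"
      using ereal_dense2 by (metis not_le)
    have "ereal (- s * q) \<le> ?h"
    proof (rule upper_packing_entropy_ge)
      show "\<forall>\<^sub>F \<epsilon> in at_right 0. \<forall>\<^sub>F n in sequentially.
          ennreal (exp (- s * q * real n)) \<le> Psi q (measure \<theta> (bowen_ball f n \<epsilon> x))"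
        using eventually_at_right_less
      proof eventually_elim
        case (elim \<epsilon>)
        have "limsup (decay_rate f \<theta> x \<epsilon>) \<le> upper_local_entropy f \<theta> x"
          using elim unfolding upper_local_entropy_eq_SUP[OF assms] by (intro SUP_upper) auto
        then have "limsup (decay_rate f \<theta> x \<epsilon>) < ereal s"
          using s(1) by (rule le_less_trans)
        then have "\<forall>\<^sub>F n in sequentially. decay_rate f \<theta> x \<epsilon> n < ereal s"
          by (rule Limsup_lessD)
        then show ?case
          using eventually_gt_at_top[of 0]
        proof eventually_elim
          case (elim n)
          then have "exp (- s * real n) < measure \<theta> (bowen_ball f n \<epsilon> x)"
            by (simp add: decay_rate_less_iff)
          then have "exp (- s * real n) powr q \<le> measure \<theta> (bowen_ball f n \<epsilon> x) powr q"
            using q by (intro powr_mono2) auto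
          then show ?case
            using q by (simp add: Psi_def ennreal_leI powr_def mult_ac)
        qed
      qed
    qed simp
    then have "- (?h / ereal q) \<le> ereal s"
      using q by (cases ?h) (auto simp: field_simps)
    then show False
      using s(2) by simp
  qed
qed

text \<open>
  For \<open>s\<close> below the lower local entropy, the mass of the balls about \<open>x\<close> is eventually smaller than
  \<open>exp (- s n)\<close> at every sufficiently small scale, and a negative power turns this into the growth
  rate \<open>u = - s q\<close>. Balls of mass 0 do no harm, as \<open>\<Psi>\<^sub>q\<close> is infinite there.
\<close>

lemma lower_local_entropy_le_beta_upper:
  assumes "continuous_on UNIV f" "finite_measure \<theta>" "sets \<theta> = sets borel"
  shows "lower_local_entropy f \<theta> x \<le> beta_upper f \<theta>"
  unfolding beta_upper_def
proof (intro INF_greatest)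
  fix q :: real
  assume "q \<in> {..<0}"
  then have q: "q < 0"
    by simp
  let ?h = "upper_packing_entropy f \<theta> q UNIV"
  show "lower_local_entropy f \<theta> x \<le> - (?h / ereal q)"
  proof (rule ccontr)
    assume "\<not> ?thesis"
    then obtain s where s: "- (?h / ereal q) < ereal s" "ereal s < lower_local_entropy f \<theta> x"
      using ereal_dense2 by (metis not_le)
    then obtain \<delta> where \<delta>: "0 < \<delta>" "ereal s < liminf (decay_rate f \<theta> x \<delta>)"
      unfolding lower_local_entropy_eq_SUP[OF assms] by (auto simp: less_SUP_iff)
    have "ereal (- s * q) \<le> ?h"
    proof (rule upper_packing_entropy_ge)
      show "\<forall>\<^sub>F \<epsilon> in at_right 0. \<forall>\<^sub>F n in sequentially.
          ennreal (exp (- s * q * real n)) \<le> Psi q (measure \<theta> (bowen_ball f n \<epsilon> x))"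
        using eventually_at_right_real[OF \<delta>(1)]
      proof eventually_elim
        case (elim \<epsilon>)
        have "\<forall>\<^sub>F n in sequentially. ereal s < decay_rate f \<theta> x \<delta> n"
          using \<delta>(2) by (rule less_LiminfD)
        then show ?case
          using eventually_gt_at_top[of 0]
        proof eventually_elim
          case (elim n)
          let ?m = "measure \<theta> (bowen_ball f n \<epsilon> x)"
          have "ereal s < decay_rate f \<theta> x \<epsilon> n"
            using elim(1) decay_rate_antimono[OF assms, of \<epsilon> \<delta>] \<open>\<epsilon> \<in> {0<..<\<delta>}\<close>
            by (auto intro: less_le_trans)
          then have less: "?m < exp (- s * real n)"
            using elim(2) by (simp add: less_decay_rate_iff)
          show ?case
          proof (cases "?m = 0")
            case False
            then have "exp (- s * real n) powr q \<le> ?m powr q"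
              using q less by (intro powr_mono2') (auto simp: zero_less_measure_iff)
            then show ?thesis
              using q False by (simp add: Psi_def ennreal_leI powr_def mult_ac)
          qed (use q in \<open>simp add: Psi_def\<close>)
        qed
      qed
    qed simp
    then have "ereal s \<le> - (?h / ereal q)"
      using q by (cases ?h) (auto simp: field_simps)
    then show False
      using s(1) by simp
  qed
qed

section \<open>Covers of exponential cardinality\<close>

text \<open>
  Diameter at most \<open>\<eta>\<close> in the metric of order \<open>n\<close>, stated pointwise so that order 0, where
  every set qualifies, can start an induction.
\<close>

definition orbit_close :: "('a::metric_space \<Rightarrow> 'a) \<Rightarrow> nat \<Rightarrow> real \<Rightarrow> 'a set \<Rightarrow> bool" where
  "orbit_close f n \<eta> U \<longleftrightarrow> (\<forall>x\<in>U. \<forall>y\<in>U. \<forall>i<n. dist ((f ^^ i) x) ((f ^^ i) y) < \<eta>)"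

lemma orbit_close_bowen_ball:
  assumes "0 < n"
  shows "orbit_close f n (2 * \<epsilon>) (bowen_ball f n \<epsilon> x)"
  unfolding orbit_close_def
proof (intro ballI allI impI)
  fix y z i
  assume "y \<in> bowen_ball f n \<epsilon> x" "z \<in> bowen_ball f n \<epsilon> x" "i < n"
  then have "dist ((f ^^ i) x) ((f ^^ i) y) < \<epsilon>" "dist ((f ^^ i) x) ((f ^^ i) z) < \<epsilon>"
    using assms by (auto simp: mem_bowen_ball)
  then show "dist ((f ^^ i) y) ((f ^^ i) z) < 2 * \<epsilon>"
    using dist_triangle3[of "(f ^^ i) y" "(f ^^ i) z" "(f ^^ i) x"] by linarith
qed

lemma bowen_ball_subset_triple:
  assumes "0 < n" "bowen_ball f n \<epsilon> x \<inter> bowen_ball f n \<epsilon> y \<noteq> {}"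
  shows "bowen_ball f n \<epsilon> x \<subseteq> bowen_ball f n (3 * \<epsilon>) y"
proof
  fix z
  assume z: "z \<in> bowen_ball f n \<epsilon> x"
  obtain w where w: "w \<in> bowen_ball f n \<epsilon> x" "w \<in> bowen_ball f n \<epsilon> y"
    using assms(2) by blast
  have "dist ((f ^^ i) y) ((f ^^ i) z) < 3 * \<epsilon>" if "i < n" for i
  proof -
    have "dist ((f ^^ i) w) ((f ^^ i) z) < 2 * \<epsilon>"
      using orbit_close_bowen_ball[OF assms(1), of f \<epsilon> x] w(1) z that
      by (auto simp: orbit_close_def)
    moreover have "dist ((f ^^ i) y) ((f ^^ i) w) < \<epsilon>"
      using w(2) that by (simp add: mem_bowen_ball assms(1))
    ultimately show ?thesis
      using dist_triangle[of "(f ^^ i) y" "(f ^^ i) z" "(f ^^ i) w"] by linarith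
  qed
  then show "z \<in> bowen_ball f n (3 * \<epsilon>) y"
    by (simp add: mem_bowen_ball assms(1))
qed

text \<open>
  The selection argument of Vitali's covering lemma: a maximal disjoint subfamily is small because
  its members have large mass, and tripling the radius recovers the union of the whole family.
\<close>

lemma bowen_ball_selection:
  assumes "continuous_on UNIV f" "prob_space \<theta>" "sets \<theta> = sets borel" "0 < k" "finite X"
    and mass: "\<And>x. x \<in> X \<Longrightarrow> exp (- b * real k) \<le> measure \<theta> (bowen_ball f k \<epsilon> x)"
  shows "\<exists>E. E \<subseteq> X \<and> real (card E) \<le> exp (b * real k) \<and>
    (\<Union>x\<in>X. bowen_ball f k \<epsilon> x) \<subseteq> (\<Union>x\<in>E. bowen_ball f k (3 * \<epsilon>) x)"
proof -
  interpret prob_space \<theta> by fact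
  let ?B = "bowen_ball f k \<epsilon>"
  let ?\<D> = "{E. E \<subseteq> X \<and> disjoint_family_on ?B E}"
  have "finite ?\<D>"
    using assms(5) by simp
  moreover have "{} \<in> ?\<D>"
    by (simp add: disjoint_family_on_def)
  then have "?\<D> \<noteq> {}"
    by blast
  ultimately have "\<exists>E\<in>?\<D>. \<forall>D\<in>?\<D>. E \<subseteq> D \<longrightarrow> E = D"
    by (rule finite_has_maximal)
  then obtain E where E: "E \<subseteq> X" "disjoint_family_on ?B E"
    and maximal: "\<And>D. D \<subseteq> X \<Longrightarrow> disjoint_family_on ?B D \<Longrightarrow> E \<subseteq> D \<Longrightarrow> E = D"
    by auto
  have fin: "finite E"
    using E(1) assms(5) by (rule finite_subset)
  have "real (card E) * exp (- b * real k) = (\<Sum>x\<in>E. exp (- b * real k))"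
    by simp
  also have "\<dots> \<le> (\<Sum>x\<in>E. prob (?B x))"
    using mass E(1) by (intro sum_mono) auto
  also have "\<dots> = prob (\<Union>x\<in>E. ?B x)"
    using fin E(2) assms(3) open_bowen_ball[OF assms(1)]
    by (intro finite_measure_finite_Union[symmetric]) auto
  also have "\<dots> \<le> 1"
    by simp
  finally have card: "real (card E) \<le> exp (b * real k)"
    by (simp add: exp_minus field_simps)
  have triple: "\<exists>y\<in>E. ?B x \<subseteq> bowen_ball f k (3 * \<epsilon>) y" if x: "x \<in> X" for x
  proof (cases "\<exists>y\<in>E. ?B x \<inter> ?B y \<noteq> {}")
    case True
    then show ?thesis
      using bowen_ball_subset_triple[OF assms(4)] by blast
  next
    case False
    then have "disjoint_family_on ?B (insert x E)"
      using E(2) by (auto simp: disjoint_family_on_def)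
    then have "E = insert x E"
      using x E(1) by (intro maximal) auto
    then have "x \<in> E"
      by blast
    then have "?B x = {}"
      using False by blast
    then show ?thesis
      using \<open>x \<in> E\<close> by blast
  qed
  have "(\<Union>x\<in>X. ?B x) \<subseteq> (\<Union>x\<in>E. bowen_ball f k (3 * \<epsilon>) x)"
  proof (rule UN_least)
    fix x
    assume "x \<in> X"
    then obtain y where "y \<in> E" "?B x \<subseteq> bowen_ball f k (3 * \<epsilon>) y"
      using triple by auto
    then show "?B x \<subseteq> (\<Union>x\<in>E. bowen_ball f k (3 * \<epsilon>) x)"
      by auto
  qed
  then show ?thesis
    using E(1) card by (intro exI[of _ E] conjI)
qed

text \<open>
  A Kraft inequality. The pieces \<open>p\<close> have lengths \<open>k p\<close>; an orbit of length \<open>n\<close> is cut into a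
  first piece and an orbit of length \<open>n - k p\<close>, the subtraction being truncated because the last
  piece may overshoot by at most \<open>M\<close>. This is where the factor \<open>exp (c M)\<close> comes from. The clause
  for \<open>n = 0\<close> is there for the induction.
\<close>

lemma open_covers_from_pieces:
  fixes k :: "'p \<Rightarrow> nat" and f :: "'a::metric_space \<Rightarrow> 'a"
  assumes cont: "continuous_on UNIV f" and "finite P" and "0 \<le> c"
    and k: "\<And>p. p \<in> P \<Longrightarrow> 0 < k p" "\<And>p. p \<in> P \<Longrightarrow> k p \<le> M"
    and V: "\<And>p. p \<in> P \<Longrightarrow> open (V p)" "\<And>p. p \<in> P \<Longrightarrow> orbit_close f (k p) \<eta> (V p)"
    and cover: "(\<Union>p\<in>P. V p) = UNIV"
    and weight: "(\<Sum>p\<in>P. exp (- c * real (k p))) \<le> 1"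
  shows "\<exists>\<U>. finite \<U> \<and> \<Union>\<U> = UNIV \<and> (\<forall>U\<in>\<U>. open U \<and> orbit_close f n \<eta> U) \<and>
    real (card \<U>) \<le> exp (c * real M) * exp (c * real n) \<and> (n = 0 \<longrightarrow> card \<U> = 1)"
proof (induction n rule: less_induct)
  case (less n)
  show ?case
  proof (cases "n = 0")
    case True
    then show ?thesis
      using assms(3) by (intro exI[of _ "{UNIV}"]) (auto simp: orbit_close_def)
  next
    case False
    let ?good = "\<lambda>j \<U>. finite \<U> \<and> \<Union>\<U> = UNIV \<and> (\<forall>U\<in>\<U>. open U \<and> orbit_close f j \<eta> U) \<and>
      real (card \<U>) \<le> exp (c * real M) * exp (c * real j) \<and> (j = 0 \<longrightarrow> card \<U> = 1)"
    have "\<forall>p\<in>P. \<exists>\<U>. ?good (n - k p) \<U>"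
      using k(1) False by (intro ballI less.IH) auto
    from bchoice[OF this] obtain \<W> where good: "\<forall>p\<in>P. ?good (n - k p) (\<W> p)"
      by (rule exE)
    have \<W>: "\<And>p. p \<in> P \<Longrightarrow> finite (\<W> p)" "\<And>p. p \<in> P \<Longrightarrow> \<Union>(\<W> p) = UNIV"
      "\<And>p U. p \<in> P \<Longrightarrow> U \<in> \<W> p \<Longrightarrow> open U \<and> orbit_close f (n - k p) \<eta> U"
      "\<And>p. p \<in> P \<Longrightarrow> real (card (\<W> p)) \<le> exp (c * real M) * exp (c * real (n - k p))"
      "\<And>p. p \<in> P \<Longrightarrow> n - k p = 0 \<Longrightarrow> card (\<W> p) = 1"
      using good by auto
    define \<U> where "\<U> = (\<Union>p\<in>P. (\<lambda>W. V p \<inter> (f ^^ k p) -` W) ` \<W> p)"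
    have "finite \<U>"
      using \<W>(1) assms(2) by (auto simp: \<U>_def)
    moreover have "\<Union>\<U> = UNIV"
    proof -
      have "x \<in> \<Union>\<U>" for x
      proof -
        obtain p where p: "p \<in> P" "x \<in> V p"
          using cover by blast
        then obtain W where "W \<in> \<W> p" "(f ^^ k p) x \<in> W"
          using \<W>(2) by blast
        then show ?thesis
          using p by (auto simp: \<U>_def)
      qed
      then show ?thesis
        by blast
    qed
    moreover have "open U \<and> orbit_close f n \<eta> U" if "U \<in> \<U>" for U
    proof -
      obtain p W where p: "p \<in> P" "W \<in> \<W> p" and U: "U = V p \<inter> (f ^^ k p) -` W"
        using \<open>U \<in> \<U>\<close> by (auto simp: \<U>_def)
      have "open ((f ^^ k p) -` W)"
        using \<W>(3)[OF p] continuous_on_funpow[OF cont] by (intro open_vimage) auto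
      then have "open U"
        unfolding U using V(1)[OF p(1)] by (intro open_Int)
      moreover have "dist ((f ^^ i) x) ((f ^^ i) y) < \<eta>" if "x \<in> U" "y \<in> U" "i < n" for x y i
      proof (cases "i < k p")
        case True
        then show ?thesis
          using that V(2)[OF p(1)] by (auto simp: U orbit_close_def)
      next
        case False
        then have "(f ^^ i) z = (f ^^ (i - k p)) ((f ^^ k p) z)" for z
          using funpow_add[of "i - k p" "k p" f] by (simp add: fun_eq_iff)
        moreover have "i - k p < n - k p"
          using False that(3) by simp
        ultimately show ?thesis
          using that \<W>(3)[OF p] by (auto simp: U orbit_close_def)
      qed
      ultimately show ?thesis
        by (auto simp: orbit_close_def)
    qed
    moreover have "real (card \<U>) \<le> exp (c * real M) * exp (c * real n)"
    proof -
      have "card \<U> \<le> (\<Sum>p\<in>P. card ((\<lambda>W. V p \<inter> (f ^^ k p) -` W) ` \<W> p))"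
        unfolding \<U>_def using assms(2) by (rule card_UN_le)
      also have "\<dots> \<le> (\<Sum>p\<in>P. card (\<W> p))"
        using \<W>(1) by (intro sum_mono card_image_le)
      finally have "real (card \<U>) \<le> (\<Sum>p\<in>P. real (card (\<W> p)))"
        by (metis of_nat_le_iff of_nat_sum)
      also have "\<dots> \<le> (\<Sum>p\<in>P. exp (c * real M) * exp (c * real n) * exp (- c * real (k p)))"
      proof (intro sum_mono)
        fix p
        assume p: "p \<in> P"
        show "real (card (\<W> p)) \<le> exp (c * real M) * exp (c * real n) * exp (- c * real (k p))"
        proof (cases "k p \<le> n")
          case True
          then show ?thesis
            using \<W>(4)[OF p]
            by (simp add: exp_add[symmetric] of_nat_diff right_diff_distrib add_diff_eq)
        next
          case False
          \<comment> \<open>The last piece overshoots: one set suffices, whereas the general bound at order 0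
            exceeds what is available by the factor \<open>exp (c (k p - n))\<close>.\<close>
          have "0 \<le> c * (real M + real n - real (k p))"
            using assms(3) k(2)[OF p] by (intro mult_nonneg_nonneg) auto
          then have "1 \<le> exp (c * (real M + real n - real (k p)))"
            by simp
          also have "\<dots> = exp (c * real M) * exp (c * real n) * exp (- c * real (k p))"
            by (simp add: exp_add[symmetric] algebra_simps)
          finally show ?thesis
            using \<W>(5)[OF p] False by simp
        qed
      qed
      also have "\<dots> = exp (c * real M) * exp (c * real n) * (\<Sum>p\<in>P. exp (- c * real (k p)))"
        by (simp add: sum_distrib_left)
      also have "\<dots> \<le> exp (c * real M) * exp (c * real n) * 1"
        using weight by (intro mult_left_mono) auto
      finally show ?thesis
        by simp
    qed
    ultimately show ?thesis
      using False by blast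
  qed
qed

lemma geometric_tail_le:
  fixes r :: real
  assumes "0 \<le> r" "r < 1" "finite K" "\<And>k. k \<in> K \<Longrightarrow> N \<le> k"
  shows "(\<Sum>k\<in>K. r ^ k) \<le> r ^ N / (1 - r)"
proof -
  have inj: "inj_on (\<lambda>k. k - N) K"
    using assms(4) by (intro inj_onI) (rule eq_diff_iff[THEN iffD1])
  have "(\<Sum>k\<in>K. r ^ k) = (\<Sum>k\<in>K. r ^ N * r ^ (k - N))"
    using assms(4) by (intro sum.cong) (simp_all add: power_add[symmetric])
  also have "\<dots> = r ^ N * (\<Sum>j\<in>(\<lambda>k. k - N) ` K. r ^ j)"
    using inj by (simp add: sum_distrib_left sum.reindex)
  also have "\<dots> \<le> r ^ N * (\<Sum>j. r ^ j)"
    using assms(1-3) by (intro mult_left_mono sum_le_suminf summable_geometric) auto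
  also have "\<dots> = r ^ N / (1 - r)"
    using assms(1,2) by (simp add: suminf_geometric)
  finally show ?thesis .
qed

text \<open>
  A pointwise bound on the lower local entropies at one scale thus bounds the exponential growth
  rate of the number of orbits that can be distinguished at a coarser scale. There are at most
  \<open>exp (b k)\<close> pieces of length \<open>k\<close>, so for \<open>b < c\<close> their weights sum up to at most the tail
  of a geometric series, which is at most 1 if all lengths are at least a suitable \<open>N\<close>. The
  scale \<open>6 \<epsilon>\<close> is the bound on the diameter of a ball of tripled radius.
\<close>

lemma exponential_open_covers:
  fixes f :: "'a::metric_space \<Rightarrow> 'a"
  assumes "compact (UNIV :: 'a set)" and cont: "continuous_on UNIV f"
    and "prob_space \<theta>" "sets \<theta> = sets borel" and "0 < \<epsilon>" "b < c" "0 \<le> c"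
    and heavy: "\<And>x. \<exists>\<^sub>F n in sequentially. exp (- b * real n) \<le> measure \<theta> (bowen_ball f n \<epsilon> x)"
  shows "\<exists>C. \<forall>n. \<exists>\<U>. finite \<U> \<and> \<Union>\<U> = UNIV \<and> (\<forall>U\<in>\<U>. open U \<and> orbit_close f n (6 * \<epsilon>) U) \<and>
    real (card \<U>) \<le> C * exp (c * real n)"
proof -
  define r where "r = exp (b - c)"
  have r: "0 \<le> r" "r < 1"
    using assms(6) by (auto simp: r_def)
  obtain N where N: "0 < N" "r ^ N \<le> 1 - r"
  proof -
    have "(\<lambda>n. r ^ n) \<longlonglongrightarrow> 0"
      using r by (intro LIMSEQ_realpow_zero) auto
    then have "\<forall>\<^sub>F n in sequentially. r ^ n < 1 - r"
      using r by (intro order_tendstoD) auto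
    then have "\<forall>\<^sub>F n in sequentially. 0 < n \<and> r ^ n < 1 - r"
      using eventually_gt_at_top[of 0] by eventually_elim auto
    then obtain n where "0 < n \<and> r ^ n < 1 - r"
      using eventually_happens'[OF sequentially_bot] by blast
    then show ?thesis
      using that[of n] by simp
  qed
  have "\<forall>x. \<exists>n. N \<le> n \<and> exp (- b * real n) \<le> measure \<theta> (bowen_ball f n \<epsilon> x)"
    using heavy by (auto simp: frequently_sequentially)
  from choice[OF this] obtain m where m: "\<And>x. N \<le> m x"
      "\<And>x. exp (- b * real (m x)) \<le> measure \<theta> (bowen_ball f (m x) \<epsilon> x)"
    by auto
  have "x \<in> bowen_ball f (m x) \<epsilon> x" for x
    using N(1) m(1)[of x] assms(5) by (subst mem_bowen_ball) auto
  then have "UNIV \<subseteq> (\<Union>x\<in>UNIV. bowen_ball f (m x) \<epsilon> x)"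
    by auto
  from compactE_image[OF assms(1) open_bowen_ball[OF cont] this]
  obtain X where X: "finite X" "(\<Union>x\<in>X. bowen_ball f (m x) \<epsilon> x) = UNIV"
    by (metis top.extremum_uniqueI)
  let ?selected = "\<lambda>k E. E \<subseteq> {x\<in>X. m x = k} \<and> real (card E) \<le> exp (b * real k) \<and>
      (\<Union>x\<in>{x\<in>X. m x = k}. bowen_ball f k \<epsilon> x) \<subseteq> (\<Union>x\<in>E. bowen_ball f k (3 * \<epsilon>) x)"
  have "\<forall>k\<in>m ` X. \<exists>E. ?selected k E"
  proof
    fix k
    assume "k \<in> m ` X"
    then have "0 < k"
      using N(1) m(1) less_le_trans by blast
    then show "\<exists>E. ?selected k E"
      using m(2) X(1) by (intro bowen_ball_selection[OF cont assms(3,4)]) auto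
  qed
  from bchoice[OF this] obtain E where selected: "\<forall>k\<in>m ` X. ?selected k (E k)"
    by (rule exE)
  have E: "\<And>k. k \<in> m ` X \<Longrightarrow> E k \<subseteq> {x\<in>X. m x = k}"
      "\<And>k. k \<in> m ` X \<Longrightarrow> real (card (E k)) \<le> exp (b * real k)"
      "\<And>k. k \<in> m ` X \<Longrightarrow>
        (\<Union>x\<in>{x\<in>X. m x = k}. bowen_ball f k \<epsilon> x) \<subseteq> (\<Union>x\<in>E k. bowen_ball f k (3 * \<epsilon>) x)"
    using selected by auto
  define P where "P = Sigma (m ` X) E"
  have finE: "finite (E k)" if "k \<in> m ` X" for k
    using finite_subset[OF E(1)[OF that]] X(1) by simp
  have finP: "finite P"
    unfolding P_def using X(1) finE by (intro finite_SigmaI) auto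
  have pos: "0 < fst p" if "p \<in> P" for p
    using that N(1) m(1) less_le_trans by (fastforce simp: P_def)
  have "(\<Sum>p\<in>P. exp (- c * real (fst p))) = (\<Sum>k\<in>m ` X. \<Sum>x\<in>E k. exp (- c * real k))"
    unfolding P_def using X(1) finE by (subst sum.Sigma) (auto intro: sum.cong)
  also have "\<dots> \<le> (\<Sum>k\<in>m ` X. exp (b * real k) * exp (- c * real k))"
    using E(2) by (intro sum_mono) simp
  also have "\<dots> = (\<Sum>k\<in>m ` X. r ^ k)"
    by (intro sum.cong) (simp_all add: r_def exp_of_nat_mult[symmetric] exp_add[symmetric] algebra_simps)
  also have "\<dots> \<le> r ^ N / (1 - r)"
    using r X(1) m(1) by (intro geometric_tail_le) auto
  also have "\<dots> \<le> 1"
    using N(2) r by simp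
  finally have weight: "(\<Sum>p\<in>P. exp (- c * real (fst p))) \<le> 1" .
  have cover: "(\<Union>p\<in>P. bowen_ball f (fst p) (3 * \<epsilon>) (snd p)) = UNIV"
  proof -
    have "\<exists>p\<in>P. y \<in> bowen_ball f (fst p) (3 * \<epsilon>) (snd p)" for y
    proof -
      obtain x where "x \<in> X" "y \<in> bowen_ball f (m x) \<epsilon> x"
        using X(2) by blast
      then obtain z where "z \<in> E (m x)" "y \<in> bowen_ball f (m x) (3 * \<epsilon>) z"
        using E(3)[of "m x"] by blast
      then show ?thesis
        using \<open>x \<in> X\<close> by (intro bexI[of _ "(m x, z)"]) (auto simp: P_def)
    qed
    then show ?thesis
      by blast
  qed
  have close: "orbit_close f (fst p) (6 * \<epsilon>) (bowen_ball f (fst p) (3 * \<epsilon>) (snd p))" if "p \<in> P" for p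
    using orbit_close_bowen_ball[OF pos[OF that], of f "3 * \<epsilon>"] by simp
  have "fst p \<le> Max (m ` X)" if "p \<in> P" for p
    using that X(1) by (auto simp: P_def)
  note covers = open_covers_from_pieces[OF cont finP assms(7) pos this open_bowen_ball[OF cont]
      close cover weight]
  have "\<exists>\<U>. finite \<U> \<and> \<Union>\<U> = UNIV \<and> (\<forall>U\<in>\<U>. open U \<and> orbit_close f n (6 * \<epsilon>) U) \<and>
      real (card \<U>) \<le> exp (c * real (Max (m ` X))) * exp (c * real n)" for n
  proof -
    obtain \<U> where "finite \<U> \<and> \<Union>\<U> = UNIV \<and> (\<forall>U\<in>\<U>. open U \<and> orbit_close f n (6 * \<epsilon>) U) \<and>
        real (card \<U>) \<le> exp (c * real (Max (m ` X))) * exp (c * real n) \<and> (n = 0 \<longrightarrow> card \<U> = 1)"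
      using covers[of n] by (rule exE)
    then show ?thesis
      by (intro exI[of _ \<U>]) simp
  qed
  then show ?thesis
    by (intro exI[of _ "exp (c * real (Max (m ` X)))"] allI)
qed

section \<open>Almost everywhere bounds from covers\<close>

text \<open>
  The ball of radius \<open>\<eta>\<close> about a point contains every member of the cover in which the point lies,
  so it is heavy unless the point lies in a light member. The light members have at most the mass
  \<open>C exp ((c - a) n)\<close> altogether, and this is summable.
\<close>

lemma AE_limsup_decay_rate_le:
  fixes f :: "'a::metric_space \<Rightarrow> 'a"
  assumes cont: "continuous_on UNIV f" and "prob_space \<theta>" "sets \<theta> = sets borel" and "c < a"
    and covers: "\<And>n. \<exists>\<U>. finite \<U> \<and> \<Union>\<U> = UNIV \<and> (\<forall>U\<in>\<U>. open U \<and> orbit_close f n \<eta> U) \<and>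
      real (card \<U>) \<le> C * exp (c * real n)"
  shows "AE x in \<theta>. limsup (decay_rate f \<theta> x \<eta>) \<le> ereal a"
proof -
  interpret prob_space \<theta> by fact
  let ?good = "\<lambda>n \<U>. finite \<U> \<and> \<Union>\<U> = UNIV \<and> (\<forall>U\<in>\<U>. open U \<and> orbit_close f n \<eta> U) \<and>
    real (card \<U>) \<le> C * exp (c * real n)"
  have "\<forall>n. \<exists>\<U>. ?good n \<U>"
    using covers by (rule allI)
  from choice[OF this] obtain \<U> where good: "\<forall>n. ?good n (\<U> n)"
    by (rule exE)
  have \<U>: "\<And>n. finite (\<U> n)" "\<And>n. \<Union>(\<U> n) = UNIV"
      "\<And>n U. U \<in> \<U> n \<Longrightarrow> open U \<and> orbit_close f n \<eta> U"
      "\<And>n. real (card (\<U> n)) \<le> C * exp (c * real n)"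
    using good by auto
  define L where "L n = {U \<in> \<U> n. prob U \<le> exp (- a * real n)}" for n
  have L: "finite (L n)" "L n \<subseteq> \<U> n" for n
    using \<U>(1) by (auto simp: L_def)
  have meas: "U \<in> sets \<theta>" if "U \<in> L n" for U n
    using \<U>(3)[OF subsetD[OF L(2) that]] assms(3) by simp
  have bound: "prob (\<Union>(L n)) \<le> C * exp (c - a) ^ n" for n
  proof -
    have "prob (\<Union>U\<in>L n. U) \<le> (\<Sum>U\<in>L n. prob U)"
      using L(1) meas by (intro finite_measure_subadditive_finite) auto
    also have "\<dots> \<le> (\<Sum>U\<in>L n. exp (- a * real n))"
      by (intro sum_mono) (simp add: L_def)
    also have "\<dots> = real (card (L n)) * exp (- a * real n)"
      by simp
    also have "\<dots> \<le> (C * exp (c * real n)) * exp (- a * real n)"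
      using card_mono[OF \<U>(1) L(2), of n] \<U>(4)[of n] by (intro mult_right_mono) auto
    also have "\<dots> = C * exp (c - a) ^ n"
      by (simp add: exp_of_nat_mult[symmetric] exp_add[symmetric] algebra_simps)
    finally show ?thesis
      by simp
  qed
  have "summable (\<lambda>n. prob (\<Union>(L n)))"
  proof (rule summable_comparison_test')
    show "summable (\<lambda>n. C * exp (c - a) ^ n)"
      using assms(4) by (intro summable_mult summable_geometric) auto
  qed (use bound in simp)
  moreover have "\<Union>(L n) \<in> sets \<theta>" for n
    using L(1) meas by (intro sets.finite_Union) auto
  ultimately have "AE x in \<theta>. \<forall>\<^sub>F n in sequentially. x \<in> space \<theta> - \<Union>(L n)"
    by (intro borel_cantelli_AE1) (auto simp: emeasure_eq_measure)
  then show ?thesis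
  proof eventually_elim
    case (elim x)
    have "\<forall>\<^sub>F n in sequentially. decay_rate f \<theta> x \<eta> n \<le> ereal a"
      using elim eventually_gt_at_top[of 0]
    proof eventually_elim
      case (elim n)
      obtain U where U: "U \<in> \<U> n" "x \<in> U"
        using \<U>(2) by blast
      then have "exp (- a * real n) < prob U"
        using elim(1) by (force simp: L_def)
      also have "\<dots> \<le> prob (bowen_ball f n \<eta> x)"
      proof (rule finite_measure_mono)
        show "U \<subseteq> bowen_ball f n \<eta> x"
          using \<U>(3)[OF U(1)] U(2) elim(2) by (auto simp: mem_bowen_ball orbit_close_def)
      qed (use open_bowen_ball[OF cont] assms(3) in simp)
      finally show ?case
        using elim(2) by (simp add: decay_rate_less_iff less_imp_le)
    qed
    then show ?case
      by (rule Limsup_bounded)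
  qed
qed

text \<open>
  If the inequality failed, two numbers \<open>b < a\<close> would fit strictly between the two sides. The
  covers obtained from \<open>b\<close> then bound the upper local entropy by \<open>a\<close> almost everywhere, hence at
  some point; by monotonicity in the scale, countably many scales are enough.
\<close>

lemma INF_upper_local_entropy_le_SUP_lower:
  fixes f :: "'a::metric_space \<Rightarrow> 'a"
  assumes "compact (UNIV :: 'a set)" and cont: "continuous_on UNIV f"
    and "prob_space \<theta>" and sets: "sets \<theta> = sets borel"
  shows "(INF x. upper_local_entropy f \<theta> x) \<le> (SUP x. lower_local_entropy f \<theta> x)"
proof (rule ccontr)
  interpret prob_space \<theta> by fact
  let ?upper = "upper_local_entropy f \<theta>" and ?lower = "lower_local_entropy f \<theta>"
  note upper_eq = upper_local_entropy_eq_SUP[OF cont finite_measure_axioms sets]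
  note lower_eq = lower_local_entropy_eq_SUP[OF cont finite_measure_axioms sets]
  assume "\<not> ?thesis"
  then have "(SUP x. ?lower x) < (INF x. ?upper x)"
    by simp
  then obtain b a where ba: "(SUP x. ?lower x) < ereal b" "b < a" "ereal a < (INF x. ?upper x)"
    using ereal_dense2 by (metis less_ereal.simps(1))
  obtain c where c: "b < c" "c < a"
    using dense[OF ba(2)] by blast
  have heavy: "\<exists>\<^sub>F n in sequentially. exp (- b * real n) \<le> prob (bowen_ball f n \<epsilon> x)"
    if "0 < \<epsilon>" for \<epsilon> x
  proof -
    have "liminf (decay_rate f \<theta> x \<epsilon>) \<le> ?lower x"
      unfolding lower_eq using that by (intro SUP_upper) auto
    also have "\<dots> \<le> (SUP x. ?lower x)"
      by (intro SUP_upper) simp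
    also have "\<dots> < ereal b"
      by (rule ba(1))
    finally have "\<not> (\<forall>\<^sub>F n in sequentially. ereal b \<le> decay_rate f \<theta> x \<epsilon> n)"
      using Liminf_bounded[of "ereal b" "decay_rate f \<theta> x \<epsilon>" sequentially] by auto
    then have "\<exists>\<^sub>F n in sequentially. decay_rate f \<theta> x \<epsilon> n < ereal b"
      by (simp add: frequently_def not_less)
    then have "\<exists>\<^sub>F n in sequentially. decay_rate f \<theta> x \<epsilon> n < ereal b \<and> 0 < n"
      using eventually_gt_at_top by (rule frequently_eventually_frequently)
    then show ?thesis
      by (rule frequently_elim1) (auto simp: decay_rate_less_iff)
  qed
  \<comment> \<open>A mass is at most 1, so it cannot be bounded below by a growing exponential.\<close>
  have "0 \<le> b"
  proof -
    obtain n where n: "0 < n" "exp (- b * real n) \<le> prob (bowen_ball f n 1 undefined)"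
      using heavy[of 1 undefined] unfolding frequently_sequentially
      by (metis Suc_le_lessD zero_less_one)
    have "exp (- b * real n) \<le> 1"
      using order_trans[OF n(2) prob_le_1] by simp
    then show ?thesis
      using n(1) by (simp add: zero_le_mult_iff)
  qed
  have "AE x in \<theta>. limsup (decay_rate f \<theta> x \<eta>) \<le> ereal a" if \<eta>: "0 < \<eta>" for \<eta>
  proof -
    obtain C where "\<And>n. \<exists>\<U>. finite \<U> \<and> \<Union>\<U> = UNIV \<and> (\<forall>U\<in>\<U>. open U \<and> orbit_close f n \<eta> U) \<and>
        real (card \<U>) \<le> C * exp (c * real n)"
      using exponential_open_covers[OF assms(1) cont assms(3) sets, of "\<eta> / 6" b c]
        heavy[of "\<eta> / 6"] \<eta> c(1) \<open>0 \<le> b\<close> by auto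
    then show ?thesis
      by (rule AE_limsup_decay_rate_le[OF cont assms(3) sets c(2)])
  qed
  then have "AE x in \<theta>. \<forall>m. limsup (decay_rate f \<theta> x (inverse (real (Suc m)))) \<le> ereal a"
    by (simp add: AE_all_countable)
  then obtain x where x: "\<And>m. limsup (decay_rate f \<theta> x (inverse (real (Suc m)))) \<le> ereal a"
    using eventually_happens'[OF ae_filter_bot] by blast
  have "?upper x \<le> ereal a"
    unfolding upper_eq
  proof (rule SUP_least)
    fix \<epsilon> :: real
    assume "\<epsilon> \<in> {0<..}"
    then obtain m where "inverse (real (Suc m)) < \<epsilon>"
      using reals_Archimedean by auto
    then have "limsup (decay_rate f \<theta> x \<epsilon>) \<le> limsup (decay_rate f \<theta> x (inverse (real (Suc m))))"
      by (intro Limsup_mono always_eventually allI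
          decay_rate_antimono[OF cont finite_measure_axioms sets]) simp
    then show "limsup (decay_rate f \<theta> x \<epsilon>) \<le> ereal a"
      using x by (rule order_trans)
  qed
  also have "\<dots> < (INF x. ?upper x)"
    by (rule ba(3))
  also have "\<dots> \<le> ?upper x"
    by (intro INF_lower) simp
  finally show False
    by simp
qed

theorem lemma6p1:
  fixes f :: "'a::metric_space \<Rightarrow> 'a" and \<theta> :: "'a measure"
  assumes "compact (UNIV :: 'a set)"
    and "continuous_on UNIV f"
    and "invariant_borel_prob f \<theta>"
  shows "beta_lower f \<theta> \<le> (INF x. upper_local_entropy f \<theta> x)
    \<and> (INF x. upper_local_entropy f \<theta> x) \<le> (SUP x. lower_local_entropy f \<theta> x)
    \<and> (SUP x. lower_local_entropy f \<theta> x) \<le> beta_upper f \<theta>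
    \<and> (\<forall>\<beta>. \<beta> \<notin> {beta_lower f \<theta>..beta_upper f \<theta>} \<longrightarrow> entropy_level_set f \<theta> \<beta> = {})"
proof -
  have prob: "prob_space \<theta>" and sets: "sets \<theta> = sets borel"
    using assms(3) by (auto simp: invariant_borel_prob_def)
  then have fin: "finite_measure \<theta>"
    by (simp add: prob_space_def)
  have lower: "beta_lower f \<theta> \<le> upper_local_entropy f \<theta> x" for x
    by (rule beta_lower_le_upper_local_entropy[OF assms(2) fin sets])
  have upper: "lower_local_entropy f \<theta> x \<le> beta_upper f \<theta>" for x
    by (rule lower_local_entropy_le_beta_upper[OF assms(2) fin sets])
  have "\<beta> \<in> {beta_lower f \<theta>..beta_upper f \<theta>}" if "x \<in> entropy_level_set f \<theta> \<beta>" for x \<beta>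
    using lower[of x] upper[of x] that by (simp add: entropy_level_set_def)
  then have "\<forall>\<beta>. \<beta> \<notin> {beta_lower f \<theta>..beta_upper f \<theta>} \<longrightarrow> entropy_level_set f \<theta> \<beta> = {}"
    by auto
  then show ?thesis
    by (intro conjI INF_greatest SUP_least lower upper
        INF_upper_local_entropy_le_SUP_lower[OF assms(1,2) prob sets])
qed

end
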